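(* Let $|||\cdot|||$ be a norm (the source norm) on $\mathbb{R}^d$, with unit ball $B=\{x:|||x|||\le 1\}$, and, for $l\in\{1,\ldots,d\}$, let $B^{\mathcal{R}}_{(l),\star}$ be the unit ball of the associated generalized dual coordinate-$l$ norm $|||\cdot|||^{\mathcal{R}}_{(l),\star}$. Let $\varphi:\{0,1,\ldots,d\}\to\mathbb{R}_+\cup\{+\infty\}$ be a function such that $\varphi(l)>\varphi(0)=0$ for all $l\in\{1,\ldots,d\}$, and with $\varphi(l)<+\infty$ for at least one $l\in\{1,\ldots,d\}$. Then there exists a norm $|||\cdot|||^{\mathcal{R}}_{\varphi}$ on $\mathbb{R}^d$, characterized by its dual norm $|||\cdot|||^{\mathcal{R}}_{\varphi,\star}$, which has unit ball $$ B^{\mathcal{R}}_{\varphi,\star}=\bigcap_{l\in\{1,\ldots,d\}}\varphi(l)\,B^{\mathcal{R}}_{(l),\star}, $$ and $|||\cdot|||^{\mathcal{R}}_{\varphi}=\sigma_{B^{\mathcal{R}}_{\varphi,\star}}$, where by convention $(+\infty)B^{\mathcal{R}}_{(l),\star}=\mathbb{R}^d$. The norm $|||\cdot|||^{\mathcal{R}}_{\varphi}$ is the tightest norm below $\varphi\circ\ell_0$ on the unit ball $B$; in particular, $$ |||x|||^{\mathcal{R}}_{\varphi}\le\varphi\bigl(\ell_0(x)\bigr)\quad\text{for all }x\in B. $$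
   Context: $d$ is a positive integer and $\mathbb{R}^d$ has the Euclidean scalar product $\langle\cdot,\cdot\rangle$. $\ell_0(x)$ is the number of nonzero components of $x\in\mathbb{R}^d$. For $Y\subset\mathbb{R}^d$, $\sigma_Y(x)=\sup_{y\in Y}\langle x,y\rangle$ is its support function. The dual norm of a norm $N$ is $N_\star(y)=\sup_{N(x)\le 1}\langle x,y\rangle$. For $x\in\mathbb{R}^d$ and $K\subset\{1,\ldots,d\}$, $x_K\in\mathbb{R}^d$ is the vector which coincides with $x$ except that its components outside $K$ are zero. Let $\mathcal{R}_K=\{x\in\mathbb{R}^d: x_j=0\ \forall j\notin K\}$. The $K$-restriction norm $|||\cdot|||_K$ is the restriction of the source norm $|||\cdot|||$ to $\mathcal{R}_K$, and $|||\cdot|||_{K,\star}$ is its dual norm on the subspace $\mathcal{R}_K$ (first restriction, then dual): $|||y|||_{K,\star}=\sup\{\langle x,y\rangle: x\in\mathcal{R}_K,\ |||x|||\le 1\}$ for $y\in\mathcal{R}_K$. For $k\in\{1,\ldots,d\}$, the generalized dual coordinate-$k$ norm is $|||y|||^{\mathcal{R}}_{(k),\star}=\sup_{|K|\le k}|||y_K|||_{K,\star}$ for $y\in\mathbb{R}^d$. "The tightest norm below $\varphi\circ\ell_0$ on $B$" means the greatest element, for the pointwise order, of the set of norms $N$ on $\mathbb{R}^d$ such that $N(x)\le\varphi(\ell_0(x))$ for all $x\in B$. *)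

theory Defs
  imports "HOL-Analysis.Analysis"
begin

definition is_norm :: "('a::real_vector \<Rightarrow> real) \<Rightarrow> bool" where
  "is_norm N \<longleftrightarrow>
     (\<forall>x. 0 \<le> N x) \<and>
     (\<forall>x. N x = 0 \<longleftrightarrow> x = 0) \<and>
     (\<forall>a x. N (a *\<^sub>R x) = \<bar>a\<bar> * N x) \<and>
     (\<forall>x y. N (x + y) \<le> N x + N y)"

definition unit_ball :: "('a \<Rightarrow> real) \<Rightarrow> 'a set" where
  "unit_ball N = {x. N x \<le> 1}"

text \<open>Dual, with respect to the ambient scalar product, of the restriction of \<open>N\<close> to the
  subspace \<open>V\<close>. For a norm \<open>N\<close> in finite dimension the supremum is over a nonempty bounded set.\<close>

definition dual_norm_on :: "'a::real_inner set \<Rightarrow> ('a \<Rightarrow> real) \<Rightarrow> 'a \<Rightarrow> real" where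
  "dual_norm_on V N y = (SUP x\<in>{x \<in> V. N x \<le> 1}. x \<bullet> y)"

definition dual_norm :: "('a::real_inner \<Rightarrow> real) \<Rightarrow> 'a \<Rightarrow> real" where
  "dual_norm N = dual_norm_on UNIV N"

text \<open>Extended-real valued, so that no boundedness of \<open>Y\<close> is presupposed.\<close>

definition support_function :: "'a::real_inner set \<Rightarrow> 'a \<Rightarrow> ereal" where
  "support_function Y x = (SUP y\<in>Y. ereal (x \<bullet> y))"

definition l0 :: "real ^ 'n \<Rightarrow> nat" where
  "l0 x = card {i. x $ i \<noteq> 0}"

definition coord_subspace :: "'n set \<Rightarrow> (real ^ 'n) set" where
  "coord_subspace K = {x. \<forall>j. j \<notin> K \<longrightarrow> x $ j = 0}"

definition coord_proj :: "'n set \<Rightarrow> real ^ 'n \<Rightarrow> real ^ 'n" where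
  "coord_proj K x = (\<chi> j. if j \<in> K then x $ j else 0)"

definition gen_dual_coord_norm :: "(real ^ 'n \<Rightarrow> real) \<Rightarrow> nat \<Rightarrow> real ^ 'n \<Rightarrow> real" where
  "gen_dual_coord_norm N k y =
     (SUP K\<in>{K. card K \<le> k}. dual_norm_on (coord_subspace K) N (coord_proj K y))"

definition scale_set :: "ennreal \<Rightarrow> 'a::real_vector set \<Rightarrow> 'a set" where
  "scale_set c A = (if c = \<infinity> then UNIV else (\<lambda>x. enn2real c *\<^sub>R x) ` A)"

definition phi_dual_ball :: "(real ^ 'n \<Rightarrow> real) \<Rightarrow> (nat \<Rightarrow> ennreal) \<Rightarrow> (real ^ 'n) set" where
  "phi_dual_ball N \<phi> =
     (\<Inter>l\<in>{1..CARD('n)}. scale_set (\<phi> l) (unit_ball (gen_dual_coord_norm N l)))"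

definition norms_below :: "('a::real_vector \<Rightarrow> ennreal) \<Rightarrow> 'a set \<Rightarrow> ('a \<Rightarrow> real) set" where
  "norms_below f B = {N. is_norm N \<and> (\<forall>x\<in>B. ennreal (N x) \<le> f x)}"

definition tightest_norm_below ::
  "('a::real_vector \<Rightarrow> real) \<Rightarrow> ('a \<Rightarrow> ennreal) \<Rightarrow> 'a set \<Rightarrow> bool" where
  "tightest_norm_below N f B \<longleftrightarrow>
     N \<in> norms_below f B \<and> (\<forall>M\<in>norms_below f B. \<forall>x. M x \<le> N x)"

end

theory Submission
  imports Defs
begin

text \<open>
  The set \<open>phi_dual_ball N \<phi>\<close> is the intersection of the half-spaces \<open>{y. x \<bullet> y \<le> \<phi> l}\<close> over
  all \<open>x\<close> in the unit ball of \<open>N\<close> with \<open>l0 x \<le> l\<close>. It is bounded, symmetric and contains a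
  neighbourhood of the origin, so its support function is a norm, and the half-space description
  recovers it as the dual unit ball of that norm. By Hahn-Banach separation every norm is the
  support function of its dual unit ball, which gives uniqueness and reduces maximality to an
  inclusion of dual balls. As \<open>\<phi>\<close> need not be monotone, that inclusion requires a bound at level
  \<open>l\<close> to pass to vectors with \<open>l0 x < l\<close>; these are limits of vectors with exactly \<open>l\<close> nonzero
  components.
\<close>

section \<open>Norms in finite dimension: continuity and comparison with the Euclidean norm\<close>

lemma
  assumes "is_norm N"
  shows is_norm_nonneg: "0 \<le> N x"
    and is_norm_eq_0_iff: "N x = 0 \<longleftrightarrow> x = 0"
    and is_norm_scaleR: "N (a *\<^sub>R x) = \<bar>a\<bar> * N x"
    and is_norm_triangle: "N (x + y) \<le> N x + N y"
  using assms unfolding is_norm_def by blast+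

lemma is_norm_zero: "is_norm N \<Longrightarrow> N 0 = 0"
  by (simp add: is_norm_eq_0_iff)

lemma is_norm_pos: "is_norm N \<Longrightarrow> x \<noteq> 0 \<Longrightarrow> 0 < N x"
  using is_norm_nonneg[of N x] is_norm_eq_0_iff[of N x] by linarith

lemma convex_on_is_norm:
  assumes "is_norm N"
  shows "convex_on UNIV N"
proof (rule convex_onI)
  fix t :: real and x y
  assume "0 < t" "t < 1"
  then show "N ((1 - t) *\<^sub>R x + t *\<^sub>R y) \<le> (1 - t) * N x + t * N y"
    using is_norm_triangle[OF assms, of "(1 - t) *\<^sub>R x" "t *\<^sub>R y"]
    by (simp add: is_norm_scaleR[OF assms])
qed simp

text \<open>A convex function on an open subset of a finite-dimensional space is continuous, and a
  norm is convex.\<close>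

lemma continuous_on_is_norm:
  fixes N :: "'a::euclidean_space \<Rightarrow> real"
  assumes "is_norm N"
  shows "continuous_on UNIV N"
  using convex_on_continuous[OF open_UNIV convex_on_is_norm[OF assms]] .

text \<open>By compactness \<open>N\<close> attains a minimum on the Euclidean unit sphere, which is
  positive by definiteness. Its inverse serves as \<open>C\<close>, by homogeneity.\<close>

lemma is_norm_unit_ball_bounded:
  fixes N :: "'a::euclidean_space \<Rightarrow> real"
  assumes "is_norm N"
  obtains C where "0 < C" "\<And>x. N x \<le> 1 \<Longrightarrow> norm x \<le> C"
proof -
  have "compact (sphere (0::'a) 1)" "sphere (0::'a) 1 \<noteq> {}"
    by (auto simp: sphere_eq_empty)
  then obtain u where u: "u \<in> sphere 0 1" and min: "\<forall>v\<in>sphere 0 1. N u \<le> N v"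
    using continuous_attains_inf continuous_on_subset[OF continuous_on_is_norm[OF assms]]
    by (metis subset_UNIV)
  have pos: "0 < N u"
    using u by (intro is_norm_pos[OF assms]) auto
  show ?thesis
  proof
    show "0 < 1 / N u" using pos by simp
    show "norm x \<le> 1 / N u" if "N x \<le> 1" for x
    proof (cases "x = 0")
      case False
      then have "N u \<le> N ((1 / norm x) *\<^sub>R x)"
        using min by simp
      also have "\<dots> = N x / norm x"
        by (simp add: is_norm_scaleR[OF assms])
      also have "\<dots> \<le> 1 / norm x"
        using that by (simp add: divide_right_mono)
      finally show ?thesis
        using pos False by (simp add: field_simps)
    qed (use pos in simp)
  qed
qed

section \<open>Dual unit balls and the recovery of a norm from its dual ball\<close>

lemma dual_norm_on_le_iff:
  fixes N :: "'a::euclidean_space \<Rightarrow> real"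
  assumes "is_norm N" "0 \<in> V"
  shows "dual_norm_on V N y \<le> c \<longleftrightarrow> (\<forall>x\<in>V. N x \<le> 1 \<longrightarrow> x \<bullet> y \<le> c)"
proof -
  \<comment> \<open>A real supremum is meaningful only over a nonempty set bounded above:
    Cauchy-Schwarz on the bounded unit ball gives the bound, and \<open>0\<close> is an admissible
    point.\<close>
  obtain C where C: "0 < C" "\<And>x. N x \<le> 1 \<Longrightarrow> norm x \<le> C"
    using is_norm_unit_ball_bounded[OF assms(1)] by blast
  have "x \<bullet> y \<le> C * norm y" if "N x \<le> 1" for x
  proof -
    have "norm x \<le> C"
      by (rule C(2)[OF that])
    then show ?thesis
      by (meson norm_cauchy_schwarz mult_right_mono norm_ge_zero order_trans)
  qed
  then have "bdd_above ((\<lambda>x. x \<bullet> y) ` {x \<in> V. N x \<le> 1})"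
    by (auto intro!: bdd_aboveI[of _ "C * norm y"])
  moreover have "{x \<in> V. N x \<le> 1} \<noteq> {}"
    using assms(2) is_norm_zero[OF assms(1)] by force
  ultimately show ?thesis
    unfolding dual_norm_on_def by (subst cSUP_le_iff) auto
qed

lemma mem_unit_ball_dual_norm_iff:
  fixes N :: "'a::euclidean_space \<Rightarrow> real"
  assumes "is_norm N"
  shows "y \<in> unit_ball (dual_norm N) \<longleftrightarrow> (\<forall>x. x \<bullet> y \<le> N x)"
proof -
  have "(\<forall>x. N x \<le> 1 \<longrightarrow> x \<bullet> y \<le> 1) \<longleftrightarrow> (\<forall>x. x \<bullet> y \<le> N x)"
  proof (intro iffI allI)
    fix x assume *: "\<forall>x. N x \<le> 1 \<longrightarrow> x \<bullet> y \<le> 1"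
    show "x \<bullet> y \<le> N x"
    proof (cases "x = 0")
      case False
      then have pos: "0 < N x" by (rule is_norm_pos[OF assms])
      then show ?thesis
        using *[rule_format, of "(1 / N x) *\<^sub>R x"]
        by (simp add: is_norm_scaleR[OF assms] field_simps)
    qed (simp add: is_norm_zero[OF assms])
  qed (meson order_trans)
  then show ?thesis
    by (simp add: unit_ball_def dual_norm_def dual_norm_on_le_iff[OF assms])
qed

text \<open>If \<open>c < M x\<close>, a hyperplane strictly separates \<open>x\<close> from a
  closed convex sublevel set of \<open>M\<close>. Its normal, suitably rescaled, lies in the dual
  ball and pairs with \<open>x\<close> to more than \<open>c\<close>.\<close>

lemma is_norm_le_if_dual_ball_le:
  fixes M :: "'a::euclidean_space \<Rightarrow> real"
  assumes M: "is_norm M" and le: "\<And>y. y \<in> unit_ball (dual_norm M) \<Longrightarrow> x \<bullet> y \<le> c"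
  shows "M x \<le> c"
proof (rule ccontr)
  assume "\<not> M x \<le> c"
  \<comment> \<open>Testing with the zero functional gives \<open>0 \<le> c\<close>, so the level
    \<open>s\<close> is positive and \<open>0\<close> lies in the sublevel set; hence
    \<open>b < 0\<close> below.\<close>
  moreover have "0 \<in> unit_ball (dual_norm M)"
    by (simp add: mem_unit_ball_dual_norm_iff[OF M] is_norm_nonneg[OF M])
  then have "0 \<le> c" using le by fastforce
  ultimately obtain s where s: "c < s" "s < M x" "0 < s"
    using dense[of c "M x"] by fastforce
  have "convex {z. M z \<le> s}"
  proof (rule convexI, unfold mem_Collect_eq)
    fix y z :: 'a and u v :: real
    assume "M y \<le> s" "M z \<le> s" and uv: "0 \<le> u" "0 \<le> v" "u + v = 1"
    then have "u * M y + v * M z \<le> s" by (intro convex_bound_le)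
    then show "M (u *\<^sub>R y + v *\<^sub>R z) \<le> s"
      using is_norm_triangle[OF M, of "u *\<^sub>R y" "v *\<^sub>R z"] uv by (simp add: is_norm_scaleR[OF M])
  qed
  moreover have "closed {z. M z \<le> s}"
    by (rule closed_Collect_le[OF continuous_on_is_norm[OF M] continuous_on_const])
  ultimately obtain a b where ab: "a \<bullet> x < b" "\<And>z. M z \<le> s \<Longrightarrow> b < a \<bullet> z"
    using separating_hyperplane_closed_point[of "{z. M z \<le> s}" x] s by auto
  have b: "b < 0"
    using ab(2)[of 0] s(3) by (simp add: is_norm_zero[OF M])
  \<comment> \<open>Multiplying by the negative number \<open>s / b\<close> reverses both separation
    inequalities: the pairing with \<open>y\<close> stays below \<open>s\<close> on the sublevel set
    and exceeds \<open>s\<close> at \<open>x\<close>.\<close>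
  define y where "y = (s / b) *\<^sub>R a"
  have "z \<bullet> y \<le> M z" for z
  proof (cases "z = 0")
    case False
    then have pos: "0 < M z" by (rule is_norm_pos[OF M])
    then have "M ((s / M z) *\<^sub>R z) \<le> s"
      using s(3) by (simp add: is_norm_scaleR[OF M])
    then have "b < (s / M z) * (a \<bullet> z)"
      using ab(2) by fastforce
    then show ?thesis
      using pos b by (simp add: y_def field_simps inner_commute)
  qed (simp add: is_norm_zero[OF M])
  then have "x \<bullet> y \<le> c"
    by (intro le) (simp add: mem_unit_ball_dual_norm_iff[OF M])
  moreover have "s < x \<bullet> y"
    using ab(1) b s(3) by (simp add: y_def field_simps inner_commute)
  ultimately show False using s(1) by simp
qed

lemma is_norm_eq_SUP_dual_ball:
  fixes M :: "'a::euclidean_space \<Rightarrow> real"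
  assumes M: "is_norm M"
  shows "M x = (SUP y\<in>unit_ball (dual_norm M). x \<bullet> y)"
proof (rule antisym)
  have bdd: "bdd_above ((\<lambda>y. x \<bullet> y) ` unit_ball (dual_norm M))"
    by (auto intro!: bdd_aboveI[of _ "M x"] simp: mem_unit_ball_dual_norm_iff[OF M])
  show "M x \<le> (SUP y\<in>unit_ball (dual_norm M). x \<bullet> y)"
    by (rule is_norm_le_if_dual_ball_le[OF M]) (rule cSUP_upper[OF _ bdd])
  have "0 \<in> unit_ball (dual_norm M)"
    by (simp add: mem_unit_ball_dual_norm_iff[OF M] is_norm_nonneg[OF M])
  then show "(SUP y\<in>unit_ball (dual_norm M). x \<bullet> y) \<le> M x"
    using mem_unit_ball_dual_norm_iff[OF M] by (intro cSUP_least) blast+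
qed

section \<open>Support functions of bounded sets\<close>

lemma bdd_above_inner_bounded:
  fixes D :: "'a::real_inner set"
  assumes "bounded D"
  shows "bdd_above ((\<lambda>y. x \<bullet> y) ` D)"
proof -
  obtain C where "\<And>y. y \<in> D \<Longrightarrow> norm y \<le> C"
    using assms unfolding bounded_iff by blast
  then have "x \<bullet> y \<le> norm x * C" if "y \<in> D" for y
    using that norm_cauchy_schwarz[of x y] mult_left_mono[of "norm y" C "norm x"] by fastforce
  then show ?thesis
    by (auto intro!: bdd_aboveI[of _ "norm x * C"])
qed

text \<open>Boundedness makes the suprema finite, symmetry turns positive homogeneity into absolute
  homogeneity, and the ball around the origin gives definiteness.\<close>

lemma is_norm_SUP_inner:
  fixes D :: "'a::real_inner set"
  assumes bdd: "bounded D" and sym: "\<And>y. y \<in> D \<Longrightarrow> - y \<in> D"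
    and r: "0 < r" "cball 0 r \<subseteq> D"
  shows "is_norm (\<lambda>x. SUP y\<in>D. x \<bullet> y)"
proof -
  let ?f = "\<lambda>x. SUP y\<in>D. x \<bullet> y"
  have upper: "x \<bullet> y \<le> ?f x" if "y \<in> D" for x y
    using that by (intro cSUP_upper bdd_above_inner_bounded bdd)
  have zero: "0 \<in> D" using r by auto
  then have ne: "D \<noteq> {}" by auto
  have f0: "?f 0 = 0" using ne by simp
  have nonneg: "0 \<le> ?f x" for x
    using upper[OF zero, of x] by simp
  have scale_le: "?f (a *\<^sub>R x) \<le> \<bar>a\<bar> * ?f x" for a x
  proof (rule cSUP_least[OF ne])
    fix y assume y: "y \<in> D"
    show "(a *\<^sub>R x) \<bullet> y \<le> \<bar>a\<bar> * ?f x"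
    proof (cases "0 \<le> a")
      case True
      then show ?thesis using mult_left_mono[OF upper[OF y, of x], of a] by simp
    next
      case False
      then show ?thesis
        using mult_left_mono[OF upper[OF sym[OF y], of x], of "- a"] by simp
    qed
  qed
  have scale: "?f (a *\<^sub>R x) = \<bar>a\<bar> * ?f x" for a x
  proof (cases "a = 0")
    case False
    \<comment> \<open>The reverse inequality is \<open>scale_le\<close> for the inverse scalar,
      applied to \<open>a *\<^sub>R x\<close>.\<close>
    then have "?f x \<le> 1 / \<bar>a\<bar> * ?f (a *\<^sub>R x)"
      using scale_le[of "1 / a" "a *\<^sub>R x"] by (simp add: abs_divide)
    then have "\<bar>a\<bar> * ?f x \<le> ?f (a *\<^sub>R x)"
      using False by (simp add: field_simps)
    then show ?thesis using scale_le[of a x] by linarith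
  qed (use ne in simp)
  have pos: "0 < ?f x" if "x \<noteq> 0" for x
  proof -
    have "(r / norm x) *\<^sub>R x \<in> D"
      using that r by (auto simp: subset_iff)
    from upper[OF this, of x] have "r / norm x * (x \<bullet> x) \<le> ?f x" by simp
    moreover have "0 < r / norm x * (x \<bullet> x)"
      using that r(1) by simp
    ultimately show ?thesis by linarith
  qed
  have triangle: "?f (x + x') \<le> ?f x + ?f x'" for x x'
    by (rule cSUP_least[OF ne]) (simp add: inner_add_left add_mono upper)
  show ?thesis
    unfolding is_norm_def using nonneg pos f0 scale triangle by (metis less_irrefl)
qed

lemma support_function_bounded:
  assumes "bounded D" "D \<noteq> {}"
  shows "support_function D x = ereal (SUP y\<in>D. x \<bullet> y)"
proof -
  obtain y where y: "y \<in> D" using assms(2) by blast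
  have "ereal (x \<bullet> y) \<le> support_function D x"
    unfolding support_function_def using y by (rule SUP_upper)
  moreover have "support_function D x \<le> ereal (SUP y\<in>D. x \<bullet> y)"
    unfolding support_function_def
    by (intro SUP_least) (simp add: cSUP_upper bdd_above_inner_bounded assms(1))
  ultimately have "\<bar>support_function D x\<bar> \<noteq> \<infinity>" by auto
  then show ?thesis
    unfolding support_function_def by (rule ereal_SUP[symmetric])
qed

section \<open>Sparse vectors, coordinate subspaces and half-space descriptions\<close>

lemma l0_le_iff: "l0 x \<le> l \<longleftrightarrow> (\<exists>K. card K \<le> l \<and> x \<in> coord_subspace K)"
proof
  assume "l0 x \<le> l"
  then show "\<exists>K. card K \<le> l \<and> x \<in> coord_subspace K"
    by (intro exI[of _ "{i. x $ i \<noteq> 0}"]) (auto simp: l0_def coord_subspace_def)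
next
  assume "\<exists>K. card K \<le> l \<and> x \<in> coord_subspace K"
  then obtain K where K: "card K \<le> l" "x \<in> coord_subspace K" by blast
  then have "{i. x $ i \<noteq> 0} \<subseteq> K" by (auto simp: coord_subspace_def)
  from card_mono[OF finite this] show "l0 x \<le> l" using K(1) unfolding l0_def by linarith
qed

lemma l0_scaleR: "a \<noteq> 0 \<Longrightarrow> l0 (a *\<^sub>R x) = l0 x"
  by (simp add: l0_def)

lemma l0_uminus: "l0 (- x) = l0 x"
  by (simp add: l0_def)

lemma l0_axis_le: "l0 (axis i a) \<le> 1"
  by (subst l0_le_iff) (auto intro!: exI[of _ "{i}"] simp: coord_subspace_def axis_def)

lemma l0_le_CARD: "l0 (x :: real ^ 'n) \<le> CARD('n)"
  unfolding l0_def by (rule card_mono) auto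

lemma l0_pos: "x \<noteq> 0 \<Longrightarrow> 1 \<le> l0 x"
  by (auto simp: l0_def vec_eq_iff Suc_le_eq card_gt_0_iff)

text \<open>Lets the dual norm on a coordinate subspace be tested against \<open>y\<close> itself,
  so that \<open>K\<close> enters only through the test vectors.\<close>

lemma inner_coord_proj: "x \<in> coord_subspace K \<Longrightarrow> x \<bullet> coord_proj K y = x \<bullet> y"
  unfolding inner_vec_def coord_proj_def coord_subspace_def by (intro sum.cong) auto

text \<open>The coordinate subspaces with at most \<open>l\<close> coordinates have as union the
  vectors with \<open>l0 x \<le> l\<close>, so the two nested suprema merge into one.\<close>

lemma gen_dual_coord_norm_le_iff:
  assumes "is_norm N"
  shows "gen_dual_coord_norm N l y \<le> c \<longleftrightarrow> (\<forall>x. N x \<le> 1 \<longrightarrow> l0 x \<le> l \<longrightarrow> x \<bullet> y \<le> c)"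
proof -
  have "gen_dual_coord_norm N l y \<le> c \<longleftrightarrow>
      (\<forall>K\<in>{K. card K \<le> l}. dual_norm_on (coord_subspace K) N (coord_proj K y) \<le> c)"
    unfolding gen_dual_coord_norm_def by (rule cSUP_le_iff) (auto intro!: exI[of _ "{}"])
  also have "\<dots> \<longleftrightarrow> (\<forall>K. card K \<le> l \<longrightarrow> (\<forall>x\<in>coord_subspace K. N x \<le> 1 \<longrightarrow> x \<bullet> y \<le> c))"
  proof -
    have "0 \<in> coord_subspace K" for K :: "'a set" by (simp add: coord_subspace_def)
    then show ?thesis by (simp add: dual_norm_on_le_iff[OF assms] inner_coord_proj)
  qed
  also have "\<dots> \<longleftrightarrow> (\<forall>x. N x \<le> 1 \<longrightarrow> l0 x \<le> l \<longrightarrow> x \<bullet> y \<le> c)"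
    unfolding l0_le_iff by blast
  finally show ?thesis .
qed

lemma mem_scale_set_iff:
  assumes "0 < c" "c \<noteq> \<infinity>"
  shows "y \<in> scale_set c A \<longleftrightarrow> (1 / enn2real c) *\<^sub>R y \<in> A"
proof -
  have "0 < enn2real c"
    using assms by (simp add: enn2real_positive_iff top.not_eq_extremum)
  then show ?thesis
    using assms(2) by (force simp: scale_set_def image_iff)
qed

text \<open>A finite positive factor moves from the ball to the right-hand side of the inequalities;
  an infinite one gives the whole space and thus no constraint.\<close>

lemma mem_phi_dual_ball_iff:
  fixes N :: "real ^ 'n \<Rightarrow> real"
  assumes N: "is_norm N" and pos: "\<And>l. l \<in> {1..CARD('n)} \<Longrightarrow> 0 < \<phi> l"
  shows "y \<in> phi_dual_ball N \<phi> \<longleftrightarrow>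
    (\<forall>l\<in>{1..CARD('n)}. \<phi> l \<noteq> \<infinity> \<longrightarrow>
       (\<forall>x. N x \<le> 1 \<longrightarrow> l0 x \<le> l \<longrightarrow> x \<bullet> y \<le> enn2real (\<phi> l)))"
proof -
  have "y \<in> scale_set (\<phi> l) (unit_ball (gen_dual_coord_norm N l)) \<longleftrightarrow>
      (\<phi> l \<noteq> \<infinity> \<longrightarrow> (\<forall>x. N x \<le> 1 \<longrightarrow> l0 x \<le> l \<longrightarrow> x \<bullet> y \<le> enn2real (\<phi> l)))"
    if l: "l \<in> {1..CARD('n)}" for l
  proof (cases "\<phi> l = \<infinity>")
    case False
    have "0 < enn2real (\<phi> l)"
      using pos[OF l] False by (simp add: enn2real_positive_iff top.not_eq_extremum)
    then show ?thesis
      using False by (simp add: mem_scale_set_iff[OF pos[OF l]] unit_ball_def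
          gen_dual_coord_norm_le_iff[OF N] field_simps)
  qed (simp add: scale_set_def)
  then show ?thesis unfolding phi_dual_ball_def by simp
qed

text \<open>Fill up the support of \<open>x\<close> to exactly \<open>l\<close> coordinates with
  small entries, rescale into the unit ball of \<open>N\<close>, apply \<open>bound\<close>, and let
  the entries tend to zero.\<close>

lemma is_norm_le_of_l0_eq:
  fixes N M :: "real ^ 'n \<Rightarrow> real"
  assumes N: "is_norm N" and M: "is_norm M" and l: "l \<le> CARD('n)"
    and bound: "\<And>z. N z \<le> 1 \<Longrightarrow> l0 z = l \<Longrightarrow> M z \<le> c"
    and x: "N x \<le> 1" "l0 x \<le> l"
  shows "M x \<le> c"
proof -
  let ?S = "{i. x $ i \<noteq> 0}"
  obtain K where K: "?S \<subseteq> K" "card K = l"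
    using exists_subset_between[of ?S l UNIV] x(2) l unfolding l0_def by auto
  \<comment> \<open>\<open>w\<close> lives on the added coordinates only, so
    \<open>x + t *\<^sub>R w\<close> cannot cancel any entry of \<open>x\<close>.\<close>
  define w :: "real ^ 'n" where "w = (\<chi> i. if i \<in> K - ?S then 1 else 0)"
  have est: "M x \<le> c + t * (c * N w + M w)" if t: "0 < t" for t
  proof -
    define z where "z = x + t *\<^sub>R w"
    \<comment> \<open>By the triangle inequality \<open>s\<close> bounds \<open>N z\<close>;
      dividing by it leaves the support unchanged.\<close>
    define s where "s = 1 + t * N w"
    have s: "0 < s"
      using t is_norm_nonneg[OF N, of w] by (simp add: s_def add_pos_nonneg)
    have "{i. z $ i \<noteq> 0} = K"
      using K(1) t by (auto simp: z_def w_def)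
    then have "l0 ((1 / s) *\<^sub>R z) = l"
      using K(2) s by (simp add: l0_scaleR) (simp add: l0_def)
    moreover have "N z \<le> s"
      using is_norm_triangle[OF N, of x "t *\<^sub>R w"] x(1) t
      by (simp add: z_def s_def is_norm_scaleR[OF N])
    then have "N ((1 / s) *\<^sub>R z) \<le> 1"
      using s by (simp add: is_norm_scaleR[OF N])
    ultimately have "M ((1 / s) *\<^sub>R z) \<le> c" by (rule bound[rotated])
    then have "M z \<le> c * s"
      using s by (simp add: is_norm_scaleR[OF M] field_simps)
    moreover have "M x \<le> M z + t * M w"
      using is_norm_triangle[OF M, of z "(- t) *\<^sub>R w"] t
      unfolding is_norm_scaleR[OF M] by (simp add: z_def)
    ultimately show ?thesis by (simp add: s_def algebra_simps)
  qed
  have "((\<lambda>t. c + t * (c * N w + M w)) \<longlongrightarrow> c + 0 * (c * N w + M w)) (at_right 0)"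
    by (intro tendsto_intros)
  then show ?thesis
    using tendsto_lowerbound[of _ c "at_right (0::real)" "M x"] est
    by (auto simp: eventually_at_filter)
qed

section \<open>Construction of the norm from its dual ball, and its maximality\<close>

theorem proposition9:
  fixes N :: "real ^ 'n \<Rightarrow> real"
    and \<phi> :: "nat \<Rightarrow> ennreal"
  assumes "is_norm N"
    and "\<phi> 0 = 0"
    and "\<forall>l\<in>{1..CARD('n)}. \<phi> 0 < \<phi> l"
    and "\<exists>l\<in>{1..CARD('n)}. \<phi> l < \<infinity>"
  shows "\<exists>N\<phi>. is_norm N\<phi>
           \<and> unit_ball (dual_norm N\<phi>) = phi_dual_ball N \<phi>
           \<and> (\<forall>M. is_norm M \<and> unit_ball (dual_norm M) = phi_dual_ball N \<phi> \<longrightarrow> M = N\<phi>)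
           \<and> (\<forall>x. ereal (N\<phi> x) = support_function (phi_dual_ball N \<phi>) x)
           \<and> tightest_norm_below N\<phi> (\<phi> \<circ> l0) (unit_ball N)
           \<and> (\<forall>x\<in>unit_ball N. ennreal (N\<phi> x) \<le> \<phi> (l0 x))"
proof -
  note N = assms(1)
  define D where "D = phi_dual_ball N \<phi>"
  define F where "F x = (SUP y\<in>D. x \<bullet> y)" for x
  \<comment> \<open>The levels that impose a constraint; on them \<open>enn2real\<close> loses no
    information.\<close>
  let ?I = "{l \<in> {1..CARD('n)}. \<phi> l \<noteq> \<infinity>}"
  have pos: "0 < \<phi> l" if "l \<in> {1..CARD('n)}" for l
    using assms(2,3) that by metis
  have posr: "0 < enn2real (\<phi> l)" if "l \<in> ?I" for l
    using pos that by (simp add: enn2real_positive_iff top.not_eq_extremum)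
  have D_iff: "y \<in> D \<longleftrightarrow> (\<forall>l\<in>?I. \<forall>x. N x \<le> 1 \<longrightarrow> l0 x \<le> l \<longrightarrow> x \<bullet> y \<le> enn2real (\<phi> l))" for y
    unfolding D_def using mem_phi_dual_ball_iff[OF N, of \<phi> y] pos by auto
  obtain l\<^sub>0 where l\<^sub>0: "l\<^sub>0 \<in> ?I" using assms(4) by fastforce

  have sym: "- y \<in> D" if "y \<in> D" for y
    unfolding D_iff
  proof (intro ballI allI impI)
    fix l x assume "l \<in> ?I" "N x \<le> 1" "l0 x \<le> l"
    moreover have "N (- x) = N x" using is_norm_scaleR[OF N, of "- 1" x] by simp
    ultimately have "(- x) \<bullet> y \<le> enn2real (\<phi> l)"
      using that unfolding D_iff by (metis l0_uminus)
    then show "x \<bullet> - y \<le> enn2real (\<phi> l)" by simp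
  qed

  obtain C where C: "0 < C" "\<And>x. N x \<le> 1 \<Longrightarrow> norm x \<le> C"
    using is_norm_unit_ball_bounded[OF N] by blast
  obtain m where m: "0 < m" "\<And>l. l \<in> ?I \<Longrightarrow> m \<le> enn2real (\<phi> l)"
  proof
    have fin: "finite ((enn2real \<circ> \<phi>) ` ?I)" and ne: "(enn2real \<circ> \<phi>) ` ?I \<noteq> {}"
      using l\<^sub>0 by auto
    show "0 < Min ((enn2real \<circ> \<phi>) ` ?I)"
      using posr by (subst Min_gr_iff[OF fin ne]) auto
    show "Min ((enn2real \<circ> \<phi>) ` ?I) \<le> enn2real (\<phi> l)" if "l \<in> ?I" for l
      using that by (intro Min_le[OF fin]) auto
  qed
  \<comment> \<open>For \<open>x\<close> in the unit ball of \<open>N\<close>, Cauchy-Schwarz bounds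
    the pairing by \<open>C * (m / C) = m\<close>, which is below every finite level value.\<close>
  have ball: "cball 0 (m / C) \<subseteq> D"
  proof
    fix y :: "real ^ 'n" assume "y \<in> cball 0 (m / C)"
    then have y: "norm y \<le> m / C" by simp
    have "x \<bullet> y \<le> m" if "N x \<le> 1" for x
    proof -
      have "norm x * norm y \<le> C * (m / C)"
        using y C(1) C(2)[OF that] by (intro mult_mono) auto
      then show ?thesis using C(1) norm_cauchy_schwarz[of x y] by simp
    qed
    then show "y \<in> D" unfolding D_iff using m(2) by (meson order_trans)
  qed

  have bdd: "bounded D"
  proof -
    \<comment> \<open>A normalised axis vector has at most one nonzero component, so it is an
      admissible test vector at the single finite level \<open>l\<^sub>0\<close>. Symmetry of
      \<open>D\<close> supplies the lower bound.\<close>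
    have comp: "\<bar>y $ i\<bar> \<le> N (axis i 1) * enn2real (\<phi> l\<^sub>0)" if y: "y \<in> D" for y i
    proof -
      have *: "y $ i \<le> N (axis i 1) * enn2real (\<phi> l\<^sub>0)" if y: "y \<in> D" for y
      proof -
        let ?e = "axis i 1 :: real ^ 'n"
        have e: "0 < N ?e" by (rule is_norm_pos[OF N]) (simp add: axis_eq_0_iff)
        have "l0 ((1 / N ?e) *\<^sub>R ?e) \<le> l\<^sub>0"
          using l0_axis_le[of i 1] l\<^sub>0 e by (simp add: l0_scaleR)
        moreover have "N ((1 / N ?e) *\<^sub>R ?e) \<le> 1"
          using e by (simp add: is_norm_scaleR[OF N])
        ultimately have "((1 / N ?e) *\<^sub>R ?e) \<bullet> y \<le> enn2real (\<phi> l\<^sub>0)"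
          using y l\<^sub>0 unfolding D_iff by blast
        then show ?thesis using e by (simp add: inner_axis' field_simps)
      qed
      show ?thesis using *[OF y] *[OF sym[OF y]] by simp
    qed
    have "norm y \<le> (\<Sum>i\<in>UNIV. N (axis i 1) * enn2real (\<phi> l\<^sub>0))" if "y \<in> D" for y
      by (rule order_trans[OF norm_le_l1_cart]) (intro sum_mono comp that)
    then show ?thesis unfolding bounded_iff by blast
  qed

  have F: "is_norm F"
    unfolding F_def using C(1) m(1) by (intro is_norm_SUP_inner[OF bdd sym _ ball]) auto
  have "0 \<in> D" by (rule subsetD[OF ball]) (use C(1) m(1) in simp)
  then have ne: "D \<noteq> {}" by blast
  have upper: "x \<bullet> y \<le> F x" if "y \<in> D" for x y
    unfolding F_def using that by (intro cSUP_upper bdd_above_inner_bounded bdd)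
  have F_le: "F x \<le> enn2real (\<phi> l)" if "N x \<le> 1" "l0 x \<le> l" "l \<in> ?I" for x l
    unfolding F_def using that by (intro cSUP_least[OF ne]) (auto simp: D_iff)

  \<comment> \<open>The inclusion into \<open>D\<close> holds because \<open>F\<close> satisfies the
    bounds of all defining half-spaces:
    \<open>x \<bullet> y \<le> F x \<le> enn2real (\<phi> l)\<close> for each admissible
    \<open>x\<close>.\<close>
  have dual: "unit_ball (dual_norm F) = D"
  proof (intro equalityI subsetI)
    fix y assume "y \<in> unit_ball (dual_norm F)"
    then have "x \<bullet> y \<le> F x" for x by (simp add: mem_unit_ball_dual_norm_iff[OF F])
    then show "y \<in> D" unfolding D_iff using F_le by (meson order_trans)
  next
    fix y assume "y \<in> D"
    then show "y \<in> unit_ball (dual_norm F)"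
      by (simp add: mem_unit_ball_dual_norm_iff[OF F] upper)
  qed
  have unique: "M = F" if "is_norm M" "unit_ball (dual_norm M) = D" for M
    using is_norm_eq_SUP_dual_ball[OF that(1)] that(2) by (auto simp: F_def)
  have support: "ereal (F x) = support_function D x" for x
    by (simp add: F_def support_function_bounded[OF bdd ne])

  have below: "ennreal (F x) \<le> \<phi> (l0 x)" if "x \<in> unit_ball N" for x
  \<comment> \<open>The zero vector is separated because its level \<open>0\<close> lies outside
    \<open>?I\<close>; otherwise the bound is taken at the level \<open>l0 x\<close> itself.\<close>
  proof (cases "x = 0 \<or> \<phi> (l0 x) = \<infinity>")
    case True
    then show ?thesis by (auto simp: is_norm_zero[OF F])
  next
    case False
    then have "l0 x \<in> ?I" using l0_pos l0_le_CARD by auto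
    then have "F x \<le> enn2real (\<phi> (l0 x))"
      using F_le that by (auto simp: unit_ball_def)
    then show ?thesis
      using False by (metis ennreal_enn2real ennreal_leI infinity_ennreal_def top.not_eq_extremum)
  qed

  have greatest: "M x \<le> F x" if M: "is_norm M"
    and M_below: "\<And>z. z \<in> unit_ball N \<Longrightarrow> ennreal (M z) \<le> \<phi> (l0 z)" for M x
  proof -
    \<comment> \<open>The hypothesis on \<open>M\<close> controls by \<open>\<phi> l\<close> only
      vectors with exactly \<open>l\<close> nonzero components, whereas \<open>D\<close> tests all
      with at most \<open>l\<close>; density closes the gap.\<close>
    have bound: "M z \<le> enn2real (\<phi> l)" if "l \<in> ?I" "N z \<le> 1" "l0 z \<le> l" for z l
    proof (rule is_norm_le_of_l0_eq[OF N M _ _ that(2,3)])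
      show "l \<le> CARD('n)" using that(1) by simp
      fix u assume "N u \<le> 1" "l0 u = l"
      then have "ennreal (M u) \<le> \<phi> l" using M_below by (auto simp: unit_ball_def)
      then show "M u \<le> enn2real (\<phi> l)"
        using that(1) is_norm_nonneg[OF M, of u] enn2real_mono[of "ennreal (M u)" "\<phi> l"]
        by (simp add: top.not_eq_extremum)
    qed
    \<comment> \<open>Taking suprema over the smaller dual ball then yields
      \<open>M x \<le> F x\<close>.\<close>
    have "unit_ball (dual_norm M) \<subseteq> D"
    proof
      fix y assume "y \<in> unit_ball (dual_norm M)"
      then have "z \<bullet> y \<le> M z" for z by (simp add: mem_unit_ball_dual_norm_iff[OF M])
      then show "y \<in> D" unfolding D_iff using bound by (meson order_trans)
    qed
    then show ?thesis
      using upper by (intro is_norm_le_if_dual_ball_le[OF M]) blast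
  qed

  have "tightest_norm_below F (\<phi> \<circ> l0) (unit_ball N)"
    unfolding tightest_norm_below_def norms_below_def using F below greatest by simp
  then show ?thesis
    using F dual unique support below unfolding D_def by (intro exI[of _ F]) blast
qed

end
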